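(* Let $A,B,C$ be real $s\times n$ matrices, $d\in\mathbb{R}^s$, and $F(x,v_1)=\{v\in\mathbb{R}^n:Ax+Bv_1-Cv\le d\}$ for $(x,v_1)\in\mathbb{R}^{2n}$. Let $\varphi:\mathbb{R}^{2n}\to\mathbb{R}^1$ be a continuous proper convex function and $Q_0,Q_1\subseteq\mathbb{R}^n$ nonempty convex sets. Consider the problem $(PL)$: minimize $\varphi(x(1),x'(1))$ subject to $$x''(t)\in F(x(t),x'(t))\ \text{ a.e. }t\in[0,1],\qquad x(0)\in Q_0,\ x'(0)\in Q_1.$$ Then for the optimality of a feasible trajectory $\tilde x(\cdot)$ in $(PL)$ it is sufficient that there exists a function $\lambda:[0,1]\to\mathbb{R}^s$, $\lambda(t)\ge0$, $t\in[0,1]$, such that: (1) $C^*\lambda''(t)+B^*\lambda'(t)-A^*\lambda(t)=0$ and $\langle A\tilde x(t)+B\tilde x'(t)-C\tilde x''(t)-d,\lambda(t)\rangle=0$ for a.e. $t\in[0,1]$; (2) $-C^*\lambda'(0)-B^*\lambda(0)\in K^*_{Q_0}(\tilde x(0))$ and $C^*\lambda(0)\in K^*_{Q_1}(\tilde x'(0))$; (3) $\big(-C^*\lambda'(1)-B^*\lambda(1),\ C^*\lambda(1)\big)\in\partial\varphi(\tilde x(1),\tilde x'(1))$.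
   Context: Feasible trajectories are functions $x:[0,1]\to\mathbb{R}^n$ with $x,x'$ absolutely continuous and $x''\in L_1^n([0,1])$ satisfying the constraints. Vector inequalities are componentwise; $A^*,B^*,C^*$ are the transposes. The function $\lambda$ is such that $x^*:=-C^*\lambda$ is absolutely continuous together with its first derivative with $x^{*\prime\prime}\in L_1^n([0,1])$, and $\eta_1^*:=-B^*\lambda$ is absolutely continuous with derivative in $L_1^n([0,1])$; $C^*\lambda'$, $C^*\lambda''$, $B^*\lambda'$ denote the derivatives $(C^*\lambda)'$, $(C^*\lambda)''$, $(B^*\lambda)'$. For a convex set $Q$ and $x\in Q$, $K_Q(x)=\{\lambda(y-x):y\in Q,\lambda>0\}$ and $K_Q^*(x)=\{x^*:\langle\bar x,x^*\rangle\ge0\ \forall\bar x\in K_Q(x)\}$. $\partial\varphi$ is the convex subdifferential. *)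

theory Defs
  imports "HOL-Analysis.Analysis"
begin

definition abs_continuous_on :: "real set \<Rightarrow> (real \<Rightarrow> 'a::real_normed_vector) \<Rightarrow> bool" where
  "abs_continuous_on S f \<longleftrightarrow>
    (\<forall>\<epsilon>>0. \<exists>\<delta>>0. \<forall>(m::nat) a b.
       (\<forall>i<m. a i \<le> b i \<and> {a i..b i} \<subseteq> S) \<and>
       disjoint_family_on (\<lambda>i. {a i<..<b i}) {..<m} \<and>
       (\<Sum>i<m. b i - a i) < \<delta>
       \<longrightarrow> (\<Sum>i<m. norm (f (b i) - f (a i))) < \<epsilon>)"

(* One-sided at the endpoints 0 and 1; meaningful only where the derivative exists. *)
definition D01 :: "(real \<Rightarrow> 'a::real_normed_vector) \<Rightarrow> real \<Rightarrow> 'a" where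
  "D01 f t = vector_derivative f (at t within {0..1})"

(* "f is absolutely continuous and f' is in L_1". Existence of f' almost everywhere is part of
   f' being an L_1 function; it is stated since vector_derivative is a total operator. *)
definition AC_L1 :: "(real \<Rightarrow> 'a::euclidean_space) \<Rightarrow> bool" where
  "AC_L1 f \<longleftrightarrow>
     abs_continuous_on {0..1} f \<and>
     (AE t\<in>{0..1} in lebesgue. f differentiable (at t within {0..1})) \<and>
     D01 f absolutely_integrable_on {0..1}"

(* "f and f' are absolutely continuous and f'' is in L_1". Here f' is a genuine function on all
   of [0,1]: absolute continuity of f' presupposes its values everywhere, and the values
   at 0 and 1 occur in the boundary conditions. *)
definition AC2_L1 :: "(real \<Rightarrow> 'a::euclidean_space) \<Rightarrow> bool" where
  "AC2_L1 f \<longleftrightarrow>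
     abs_continuous_on {0..1} f \<and>
     (\<forall>t\<in>{0..1}. f differentiable (at t within {0..1})) \<and>
     AC_L1 (D01 f)"

(* Uses the componentwise order of real ^ 's. *)
definition polyhedral_map ::
  "real ^ 'n ^ 's \<Rightarrow> real ^ 'n ^ 's \<Rightarrow> real ^ 'n ^ 's \<Rightarrow> real ^ 's
    \<Rightarrow> (real ^ 'n) \<times> (real ^ 'n) \<Rightarrow> (real ^ 'n) set" where
  "polyhedral_map A B C d = (\<lambda>(x, v1). {v. A *v x + B *v v1 - C *v v \<le> d})"

definition feasible_trajectory ::
  "('a::euclidean_space \<times> 'a \<Rightarrow> 'a set) \<Rightarrow> 'a set \<Rightarrow> 'a set \<Rightarrow> (real \<Rightarrow> 'a) \<Rightarrow> bool" where
  "feasible_trajectory F Q0 Q1 x \<longleftrightarrow>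
     AC2_L1 x \<and>
     (AE t\<in>{0..1} in lebesgue. D01 (D01 x) t \<in> F (x t, D01 x t)) \<and>
     x 0 \<in> Q0 \<and> D01 x 0 \<in> Q1"

definition optimal_trajectory ::
  "('a::euclidean_space \<times> 'a \<Rightarrow> real) \<Rightarrow> ('a \<times> 'a \<Rightarrow> 'a set) \<Rightarrow> 'a set \<Rightarrow> 'a set
    \<Rightarrow> (real \<Rightarrow> 'a) \<Rightarrow> bool" where
  "optimal_trajectory \<phi> F Q0 Q1 x \<longleftrightarrow>
     feasible_trajectory F Q0 Q1 x \<and>
     (\<forall>y. feasible_trajectory F Q0 Q1 y \<longrightarrow> \<phi> (x 1, D01 x 1) \<le> \<phi> (y 1, D01 y 1))"

definition tangent_directions :: "'a::real_vector set \<Rightarrow> 'a \<Rightarrow> 'a set" where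
  "tangent_directions Q x = {c *\<^sub>R (y - x) | c y. y \<in> Q \<and> c > 0}"

definition dual_cone :: "'a::real_inner set \<Rightarrow> 'a set" where
  "dual_cone K = {z. \<forall>w\<in>K. w \<bullet> z \<ge> 0}"

definition subdifferential :: "('a::real_inner \<Rightarrow> real) \<Rightarrow> 'a \<Rightarrow> 'a set" where
  "subdifferential \<phi> z = {g. \<forall>w. \<phi> w - \<phi> z \<ge> g \<bullet> (w - z)}"

end

theory Submission
  imports Defs
begin

text \<open>
  Write \<open>p = - C\<^sup>T \<lambda>\<close> and \<open>r = - B\<^sup>T \<lambda>\<close>, and let \<open>z = y - x\<close> be the difference of a competing
  feasible trajectory \<open>y\<close> and the given one. Sufficiency comes from following
  \<open>h = z \<bullet> (p' + r) - z' \<bullet> p\<close> from \<open>0\<close> to \<open>1\<close>.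

  At \<open>1\<close>, the pair \<open>(p' + r, - p)\<close> is a subgradient of \<open>\<phi>\<close>, so \<open>h 1\<close> is at most the increase of
  the cost from \<open>x\<close> to \<open>y\<close>. At \<open>0\<close>, the two dual cone conditions say that \<open>h 0 \<ge> 0\<close>, because
  \<open>z 0\<close> and \<open>z' 0\<close> are tangent directions of the initial sets. In between, the product rule and
  the adjoint equation give \<open>h' = - (A z + B z' - C z'') \<bullet> \<lambda>\<close> almost everywhere, and this is
  nonnegative: the constraint residual of \<open>x\<close> is orthogonal to \<open>\<lambda>\<close>, while that of \<open>y\<close> is
  nonpositive and \<open>\<lambda> \<ge> 0\<close>. Hence the cost of \<open>y\<close> is at least that of \<open>x\<close>.

  The analytic content is that \<open>h 0 \<le> h 1\<close> follows from a sign of \<open>h'\<close> known only almost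
  everywhere, which requires \<open>h\<close> to be absolutely continuous
  (\<open>abs_continuous_on_deriv_nonneg_imp_le\<close>). That \<open>h\<close> is absolutely continuous is inherited from
  its factors, which are bounded (\<open>abs_continuous_on_inner\<close>).
\<close>

section \<open>Absolutely continuous functions\<close>

text \<open>
  Tagged divisions come as finite sets without an order, so the interval families in the definition
  of absolute continuity have to be released from their numbering.
\<close>

lemma abs_continuous_on_finite_family:
  fixes f :: "real \<Rightarrow> 'a::real_normed_vector"
  assumes "abs_continuous_on S f" and "\<epsilon> > 0"
  shows "\<exists>\<delta>>0. \<forall>(I::'i set) a b.
    finite I \<and> (\<forall>i\<in>I. a i \<le> b i \<and> {a i..b i} \<subseteq> S) \<and>
    disjoint_family_on (\<lambda>i. {a i<..<b i}) I \<and> (\<Sum>i\<in>I. b i - a i) < \<delta>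
    \<longrightarrow> (\<Sum>i\<in>I. norm (f (b i) - f (a i))) < \<epsilon>"
proof -
  from assms obtain \<delta> where "\<delta> > 0" and
    \<delta>: "\<And>(m::nat) a b. (\<forall>i<m. a i \<le> b i \<and> {a i..b i} \<subseteq> S) \<Longrightarrow>
       disjoint_family_on (\<lambda>i. {a i<..<b i}) {..<m} \<Longrightarrow> (\<Sum>i<m. b i - a i) < \<delta>
       \<Longrightarrow> (\<Sum>i<m. norm (f (b i) - f (a i))) < \<epsilon>"
    unfolding abs_continuous_on_def by meson
  have "(\<Sum>i\<in>I. norm (f (b i) - f (a i))) < \<epsilon>"
    if "finite I" and le: "\<And>i. i \<in> I \<Longrightarrow> a i \<le> b i" and sub: "\<And>i. i \<in> I \<Longrightarrow> {a i..b i} \<subseteq> S"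
      and disj: "disjoint_family_on (\<lambda>i. {a i<..<b i}) I" and less: "(\<Sum>i\<in>I. b i - a i) < \<delta>"
    for I :: "'i set" and a b
  proof -
    obtain h where h: "bij_betw h {..<card I} I"
      using ex_bij_betw_nat_finite[OF \<open>finite I\<close>] by (auto simp: atLeast0LessThan)
    then have hI: "h i \<in> I" if "i < card I" for i
      using that by (auto simp: bij_betw_def)
    have inj: "h i = h j \<longleftrightarrow> i = j" if "i < card I" "j < card I" for i j
      using h that by (auto simp: bij_betw_def inj_on_def)
    have "(\<Sum>i<card I. norm (f (b (h i)) - f (a (h i)))) < \<epsilon>"
    proof (rule \<delta>)
      show "\<forall>i<card I. a (h i) \<le> b (h i) \<and> {a (h i)..b (h i)} \<subseteq> S"
        using le sub hI by blast
      show "disjoint_family_on (\<lambda>i. {a (h i)<..<b (h i)}) {..<card I}"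
        unfolding disjoint_family_on_def
      proof (intro ballI impI)
        fix i j assume "i \<in> {..<card I}" "j \<in> {..<card I}" "i \<noteq> j"
        then show "{a (h i)<..<b (h i)} \<inter> {a (h j)<..<b (h j)} = {}"
          using disjoint_family_onD[OF disj, of "h i" "h j"] hI inj by auto
      qed
      show "(\<Sum>i<card I. b (h i) - a (h i)) < \<delta>"
        using sum.reindex_bij_betw[OF h, of "\<lambda>i. b i - a i"] less by simp
    qed
    then show ?thesis
      using sum.reindex_bij_betw[OF h, of "\<lambda>i. norm (f (b i) - f (a i))"] by simp
  qed
  with \<open>\<delta> > 0\<close> show ?thesis by (intro exI[of _ \<delta>]) auto
qed

lemma abs_continuous_on_imp_continuous_on:
  fixes f :: "real \<Rightarrow> 'a::real_normed_vector"
  assumes "abs_continuous_on {a..b} f"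
  shows "continuous_on {a..b} f"
proof (rule continuous_onI)
  fix x e assume x: "x \<in> {a..b}" and "(e::real) > 0"
  then obtain \<delta> where "\<delta> > 0" and
    \<delta>: "\<And>(m::nat) u v. (\<forall>i<m. u i \<le> v i \<and> {u i..v i} \<subseteq> {a..b}) \<Longrightarrow>
       disjoint_family_on (\<lambda>i. {u i<..<v i}) {..<m} \<Longrightarrow> (\<Sum>i<m. v i - u i) < \<delta>
       \<Longrightarrow> (\<Sum>i<m. norm (f (v i) - f (u i))) < e"
    using assms unfolding abs_continuous_on_def by meson
  have "dist (f y) (f x) \<le> e" if "y \<in> {a..b}" "dist y x < \<delta>" for y
    using \<delta>[of 1 "\<lambda>_. x" "\<lambda>_. y"] \<delta>[of 1 "\<lambda>_. y" "\<lambda>_. x"] that x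
    by (cases x y rule: linorder_le_cases)
      (auto simp: dist_norm norm_minus_commute disjoint_family_on_def)
  then show "\<exists>d>0. \<forall>x'\<in>{a..b}. dist x' x < d \<longrightarrow> dist (f x') (f x) \<le> e"
    using \<open>\<delta> > 0\<close> by blast
qed

text \<open>
  One \<open>\<epsilon>\<close>-\<open>\<delta>\<close> argument for every binary operation that is Lipschitz on the values taken: sums and
  differences always, inner products when both factors are bounded.
\<close>

lemma abs_continuous_on_dominated:
  fixes f :: "real \<Rightarrow> 'a::real_normed_vector" and g :: "real \<Rightarrow> 'b::real_normed_vector"
    and h :: "real \<Rightarrow> 'c::real_normed_vector"
  assumes f: "abs_continuous_on S f" and g: "abs_continuous_on S g" and "M > 0"
    and bound: "\<And>s t. s \<in> S \<Longrightarrow> t \<in> S \<Longrightarrow>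
      norm (h t - h s) \<le> M * norm (f t - f s) + M * norm (g t - g s)"
  shows "abs_continuous_on S h"
  unfolding abs_continuous_on_def
proof (intro allI impI)
  fix \<epsilon> :: real assume "\<epsilon> > 0"
  then have pos: "\<epsilon> / (2 * M) > 0" using \<open>M > 0\<close> by simp
  obtain \<delta>1 where "\<delta>1 > 0" and
    \<delta>1: "\<And>(m::nat) a b. (\<forall>i<m. a i \<le> b i \<and> {a i..b i} \<subseteq> S) \<Longrightarrow>
       disjoint_family_on (\<lambda>i. {a i<..<b i}) {..<m} \<Longrightarrow> (\<Sum>i<m. b i - a i) < \<delta>1
       \<Longrightarrow> (\<Sum>i<m. norm (f (b i) - f (a i))) < \<epsilon> / (2 * M)"
    using f pos unfolding abs_continuous_on_def by meson
  obtain \<delta>2 where "\<delta>2 > 0" and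
    \<delta>2: "\<And>(m::nat) a b. (\<forall>i<m. a i \<le> b i \<and> {a i..b i} \<subseteq> S) \<Longrightarrow>
       disjoint_family_on (\<lambda>i. {a i<..<b i}) {..<m} \<Longrightarrow> (\<Sum>i<m. b i - a i) < \<delta>2
       \<Longrightarrow> (\<Sum>i<m. norm (g (b i) - g (a i))) < \<epsilon> / (2 * M)"
    using g pos unfolding abs_continuous_on_def by meson
  have "(\<Sum>i<m. norm (h (b i) - h (a i))) < \<epsilon>"
    if ab: "\<forall>i<m. a i \<le> b i \<and> {a i..b i} \<subseteq> S"
      and disj: "disjoint_family_on (\<lambda>i. {a i<..<b i}) {..<m}"
      and less: "(\<Sum>i<m. b i - a i) < min \<delta>1 \<delta>2" for m :: nat and a b
  proof -
    have "(\<Sum>i<m. norm (h (b i) - h (a i)))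
        \<le> (\<Sum>i<m. M * norm (f (b i) - f (a i)) + M * norm (g (b i) - g (a i)))"
    proof (intro sum_mono bound)
      fix i assume "i \<in> {..<m}"
      then have "a i \<le> b i" "{a i..b i} \<subseteq> S" using ab by auto
      then show "a i \<in> S" "b i \<in> S" by auto
    qed
    also have "\<dots> = M * (\<Sum>i<m. norm (f (b i) - f (a i))) + M * (\<Sum>i<m. norm (g (b i) - g (a i)))"
      by (simp add: sum.distrib sum_distrib_left)
    also have "\<dots> < M * (\<epsilon> / (2 * M)) + M * (\<epsilon> / (2 * M))"
      using \<delta>1[OF ab disj] \<delta>2[OF ab disj] less \<open>M > 0\<close>
      by (intro add_strict_mono mult_strict_left_mono) auto
    also have "\<dots> = \<epsilon>" using \<open>M > 0\<close> by simp
    finally show ?thesis .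
  qed
  then show "\<exists>\<delta>>0. \<forall>(m::nat) a b. (\<forall>i<m. a i \<le> b i \<and> {a i..b i} \<subseteq> S) \<and>
       disjoint_family_on (\<lambda>i. {a i<..<b i}) {..<m} \<and> (\<Sum>i<m. b i - a i) < \<delta>
       \<longrightarrow> (\<Sum>i<m. norm (h (b i) - h (a i))) < \<epsilon>"
    using \<open>\<delta>1 > 0\<close> \<open>\<delta>2 > 0\<close> by (intro exI[of _ "min \<delta>1 \<delta>2"]) auto
qed

lemma abs_continuous_on_add:
  assumes "abs_continuous_on S f" and "abs_continuous_on S g"
  shows "abs_continuous_on S (\<lambda>t. f t + g t)"
  by (rule abs_continuous_on_dominated[OF assms, of 1])
    (use norm_triangle_ineq in \<open>auto simp: add_diff_add\<close>)

lemma abs_continuous_on_diff: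
  assumes "abs_continuous_on S f" and "abs_continuous_on S g"
  shows "abs_continuous_on S (\<lambda>t. f t - g t)"
proof (rule abs_continuous_on_dominated[OF assms, of 1])
  fix s t
  have "f t - g t - (f s - g s) = (f t - f s) - (g t - g s)" by simp
  then show "norm (f t - g t - (f s - g s)) \<le> 1 * norm (f t - f s) + 1 * norm (g t - g s)"
    using norm_triangle_ineq4[of "f t - f s" "g t - g s"] by (simp only: mult_1)
qed simp

lemma abs_continuous_on_inner:
  fixes f g :: "real \<Rightarrow> 'a::real_inner"
  assumes f: "abs_continuous_on {a..b} f" and g: "abs_continuous_on {a..b} g"
  shows "abs_continuous_on {a..b} (\<lambda>t. f t \<bullet> g t)"
proof -
  have "bounded (f ` {a..b} )" "bounded (g ` {a..b})"
    using f g by (auto intro!: compact_imp_bounded compact_continuous_image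
        abs_continuous_on_imp_continuous_on)
  then obtain M1 M2 where M1: "M1 > 0" "\<And>t. t \<in> {a..b} \<Longrightarrow> norm (f t) \<le> M1"
    and M2: "M2 > 0" "\<And>t. t \<in> {a..b} \<Longrightarrow> norm (g t) \<le> M2"
    unfolding bounded_pos by auto
  define M where "M = max M1 M2"
  show ?thesis
  proof (rule abs_continuous_on_dominated[OF f g, of M])
    fix s t assume st: "s \<in> {a..b}" "t \<in> {a..b}"
    have "f t \<bullet> g t - f s \<bullet> g s = (f t - f s) \<bullet> g t + f s \<bullet> (g t - g s)"
      by (simp add: inner_diff)
    then have "norm (f t \<bullet> g t - f s \<bullet> g s)
        \<le> norm (f t - f s) * norm (g t) + norm (f s) * norm (g t - g s)"
      using Cauchy_Schwarz_ineq2[of "f t - f s" "g t"] Cauchy_Schwarz_ineq2[of "f s" "g t - g s"]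
      by simp
    also have "\<dots> \<le> norm (f t - f s) * M + M * norm (g t - g s)"
      using M1(2)[OF st(1)] M2(2)[OF st(2)]
      by (intro add_mono mult_left_mono mult_right_mono) (auto simp: M_def)
    finally show "norm (f t \<bullet> g t - f s \<bullet> g s) \<le> M * norm (f t - f s) + M * norm (g t - g s)"
      by (simp add: mult.commute)
  qed (use M1 in \<open>auto simp: M_def\<close>)
qed

section \<open>Monotonicity from the sign of the derivative almost everywhere\<close>

lemma negligible_imp_small_open_superset:
  fixes N :: "'a::euclidean_space set"
  assumes "negligible N" and "\<delta> > 0"
  obtains U where "open U" and "N \<subseteq> U" and "U \<in> lmeasurable" and "measure lebesgue U < \<delta>"
proof -
  have N: "N \<in> lmeasurable" "measure lebesgue N = 0"
    using assms(1) by (auto simp: negligible_imp_measurable negligible_imp_measure0)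
  then obtain U where U: "open U" "N \<subseteq> U" "U - N \<in> lmeasurable"
      and small: "emeasure lebesgue (U - N) < ennreal \<delta>"
    using sets_lebesgue_outer_open[of N \<delta>] \<open>\<delta> > 0\<close> by (metis fmeasurableD)
  have "measure lebesgue (U - N) < \<delta>"
    using small U(3) by (simp add: emeasure_eq_measure2 ennreal_less_iff)
  moreover have "(U - N) \<union> N = U" using U(2) by blast
  moreover have "measure lebesgue ((U - N) \<union> N) \<le> measure lebesgue (U - N) + measure lebesgue N"
    using U(3) N(1) by (intro measure_Un_le) auto
  moreover have "(U - N) \<union> N \<in> lmeasurable"
    using U(3) N(1) by (rule fmeasurable.Un)
  ultimately show thesis using U N(2) that by auto
qed

text \<open>
  The two increments \<open>f v - f t\<close> and \<open>f t - f u\<close> are each compared with the tangent line at \<open>t\<close>.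
  The bound depends only on \<open>v - u\<close>, however unevenly \<open>u\<close> and \<open>v\<close> lie around \<open>t\<close>; this
  requires \<open>t\<close> to be between them.
\<close>

lemma straddle_lower_bound:
  fixes f :: "real \<Rightarrow> real"
  assumes "(f has_real_derivative f') (at t within S)" and "f' \<ge> 0" and "\<epsilon> > 0"
  obtains r where "r > 0"
    and "\<And>u v. \<lbrakk>u \<in> S; v \<in> S; u \<le> t; t \<le> v; u \<in> ball t r; v \<in> ball t r\<rbrakk>
      \<Longrightarrow> f v - f u \<ge> - \<epsilon> * (v - u)"
proof -
  from assms(1) obtain r where "r > 0" and
    r: "\<And>y. y \<in> S \<Longrightarrow> norm (y - t) < r \<Longrightarrow> norm (f y - f t - f' * (y - t)) \<le> \<epsilon> * norm (y - t)"
    using \<open>\<epsilon> > 0\<close> unfolding has_field_derivative_def has_derivative_within_alt by blast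
  have "f v - f u \<ge> - \<epsilon> * (v - u)"
    if uv: "u \<in> S" "v \<in> S" "u \<le> t" "t \<le> v" "u \<in> ball t r" "v \<in> ball t r" for u v
  proof -
    have "\<bar>f v - f t - f' * (v - t)\<bar> \<le> \<epsilon> * (v - t)" "\<bar>f u - f t - f' * (u - t)\<bar> \<le> \<epsilon> * (t - u)"
      using r[of v] r[of u] uv by (auto simp: dist_real_def)
    moreover have "f' * (v - t) \<ge> 0" "f' * (u - t) \<le> 0"
      using uv \<open>f' \<ge> 0\<close> by (auto simp: mult_nonneg_nonpos)
    ultimately show ?thesis by (simp add: algebra_simps)
  qed
  with \<open>r > 0\<close> show thesis by (rule that)
qed

text \<open>
  Up to an arbitrary \<open>\<epsilon>\<close>, the increment \<open>f b - f a\<close> is split along a fine tagged division.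
  At a tag where the derivative exists and is nonnegative, the gauge makes the increment at least
  \<open>- \<epsilon>\<close> times the length of the interval. The intervals with exceptional tags lie in an open set of
  small measure, so absolute continuity makes their total increment small. The gauge takes the
  place of a Vitali covering or of Lebesgue's fundamental theorem of calculus.
\<close>

lemma abs_continuous_on_deriv_nonneg_imp_le:
  fixes f :: "real \<Rightarrow> real"
  assumes "a \<le> b" and ac: "abs_continuous_on {a..b} f" and N: "negligible N"
    and deriv: "\<And>t. t \<in> {a..b} - N \<Longrightarrow>
      \<exists>f'\<ge>0. (f has_real_derivative f') (at t within {a..b})"
  shows "f a \<le> f b"
proof (rule field_le_epsilon)
  fix e :: real assume "e > 0"
  \<comment> \<open>Half of \<open>e\<close> goes to each kind of tag; the \<open>+ 1\<close> covers the case \<open>a = b\<close>.\<close>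
  define \<epsilon> where "\<epsilon> = e / (2 * (b - a + 1))"
  have "\<epsilon> > 0" using \<open>e > 0\<close> \<open>a \<le> b\<close> by (simp add: \<epsilon>_def)
  obtain \<delta> where "\<delta> > 0" and
    \<delta>: "\<forall>(I::(real \<times> real set) set) u v.
      finite I \<and> (\<forall>i\<in>I. u i \<le> v i \<and> {u i..v i} \<subseteq> {a..b}) \<and>
      disjoint_family_on (\<lambda>i. {u i<..<v i}) I \<and> (\<Sum>i\<in>I. v i - u i) < \<delta>
      \<longrightarrow> (\<Sum>i\<in>I. norm (f (v i) - f (u i))) < e / 2"
    using abs_continuous_on_finite_family[OF ac half_gt_zero[OF \<open>e > 0\<close>]] by blast
  obtain U where U: "open U" "N \<subseteq> U" "U \<in> lmeasurable" "measure lebesgue U < \<delta>"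
    using negligible_imp_small_open_superset[OF N \<open>\<delta> > 0\<close>] .
  have "\<exists>r>0. \<forall>u v. u \<in> {a..b} \<longrightarrow> v \<in> {a..b} \<longrightarrow> u \<le> t \<longrightarrow> t \<le> v \<longrightarrow> u \<in> ball t r \<longrightarrow>
      v \<in> ball t r \<longrightarrow> f v - f u \<ge> - \<epsilon> * (v - u)" if "t \<in> {a..b} - N" for t
    using deriv[OF that] straddle_lower_bound[OF _ _ \<open>\<epsilon> > 0\<close>] by metis
  then obtain r where r: "\<And>t. t \<in> {a..b} - N \<Longrightarrow> r t > 0"
    "\<And>t u v. \<lbrakk>t \<in> {a..b} - N; u \<in> {a..b}; v \<in> {a..b}; u \<le> t; t \<le> v; u \<in> ball t (r t);
      v \<in> ball t (r t)\<rbrakk> \<Longrightarrow> f v - f u \<ge> - \<epsilon> * (v - u)"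
    by metis
  define \<gamma> where "\<gamma> t = (if t \<in> N then U else if t \<in> {a..b} then ball t (r t) else UNIV)" for t
  have "gauge \<gamma>"
    using U r(1) by (auto simp: gauge_def \<gamma>_def)
  then obtain p where p: "p tagged_division_of {a..b}" and fine: "\<gamma> fine p"
    by (rule fine_division_exists_real)
  define u v where "u i = Inf (snd i)" and "v i = Sup (snd i)" for i :: "real \<times> real set"
  have K: "snd i = {u i..v i}" "u i \<le> fst i" "fst i \<le> v i" "{u i..v i} \<subseteq> {a..b}"
    "{u i..v i} \<subseteq> \<gamma> (fst i)" if "i \<in> p" for i
  proof -
    obtain t k where i: "i = (t, k)" by force
    with that have tk: "(t, k) \<in> p" by simp
    obtain c d where cd: "k = {c..d}"
      using tagged_division_ofD(4)[OF p tk] by auto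
    have t: "t \<in> k" "k \<subseteq> {a..b}" "k \<subseteq> \<gamma> t"
      using tagged_division_ofD(2,3)[OF p tk] fineD[OF fine tk] by blast+
    have "u i = c" "v i = d" using t(1) by (auto simp: u_def v_def i cd)
    then show "snd i = {u i..v i}" "u i \<le> fst i" "fst i \<le> v i" "{u i..v i} \<subseteq> {a..b}"
      "{u i..v i} \<subseteq> \<gamma> (fst i)" using t by (auto simp: i cd)
  qed
  have uv_le: "u i \<le> v i" if "i \<in> p" for i
    using K(2,3)[OF that] by (rule order_trans)
  have "finite p" using p by (rule tagged_division_ofD)
  have disj: "{u i<..<v i} \<inter> {u j<..<v j} = {}" if "i \<in> p" "j \<in> p" "i \<noteq> j" for i j
  proof -
    have "interior (snd i) \<inter> interior (snd j) = {}"
      using that by (intro tagged_division_ofD(5)[OF p, of "fst i" _ "fst j"]) (auto simp: prod_eq_iff)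
    then show ?thesis
      by (simp only: K(1)[OF that(1)] K(1)[OF that(2)] interior_atLeastAtMost_real)
  qed
  \<comment> \<open>Intervals with an exceptional tag: their total length is below \<open>\<delta>\<close>, as they lie in \<open>U\<close>.\<close>
  define B where "B = {i \<in> p. fst i \<in> N}"
  have "finite B" "B \<subseteq> p" using \<open>finite p\<close> by (auto simp: B_def)
  have "(\<Sum>i\<in>B. v i - u i) = (\<Sum>i\<in>B. measure lebesgue {u i<..<v i})"
    using uv_le \<open>B \<subseteq> p\<close> by (intro sum.cong) auto
  also have "\<dots> = measure lebesgue (\<Union>i\<in>B. {u i<..<v i})"
  proof (rule measure_UNION'[symmetric])
    show "pairwise (\<lambda>i j. disjnt {u i<..<v i} {u j<..<v j}) B"
      unfolding pairwise_def disjnt_def using disj \<open>B \<subseteq> p\<close> by blast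
  qed (use \<open>finite B\<close> in auto)
  also have "\<dots> \<le> measure lebesgue U"
  proof (rule measure_mono_fmeasurable)
    show "(\<Union>i\<in>B. {u i<..<v i}) \<subseteq> U"
      using K(5) by (fastforce simp: B_def \<gamma>_def)
  qed (use \<open>finite B\<close> U in auto)
  finally have "(\<Sum>i\<in>B. v i - u i) < \<delta>" using U by simp
  moreover have "\<forall>i\<in>B. u i \<le> v i \<and> {u i..v i} \<subseteq> {a..b}"
    using uv_le K(4) \<open>B \<subseteq> p\<close> by blast
  moreover have "disjoint_family_on (\<lambda>i. {u i<..<v i}) B"
    unfolding disjoint_family_on_def using disj \<open>B \<subseteq> p\<close> by blast
  ultimately have "(\<Sum>i\<in>B. norm (f (v i) - f (u i))) < e / 2"
    using \<delta> \<open>finite B\<close> by blast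
  moreover have "\<bar>\<Sum>i\<in>B. f (v i) - f (u i)\<bar> \<le> (\<Sum>i\<in>B. norm (f (v i) - f (u i)))"
    by simp
  ultimately have bad: "(\<Sum>i\<in>B. f (v i) - f (u i)) \<ge> - (e / 2)" by linarith
  have good: "f (v i) - f (u i) \<ge> - \<epsilon> * (v i - u i)" if "i \<in> p - B" for i
  proof -
    have i: "i \<in> p" "fst i \<notin> N" using that by (auto simp: B_def)
    note Ki = K[OF i(1)]
    have "fst i \<in> {a..b}" "u i \<in> {a..b}" "v i \<in> {a..b}" using Ki by auto
    moreover have "\<gamma> (fst i) = ball (fst i) (r (fst i))" using i calculation by (simp add: \<gamma>_def)
    ultimately show ?thesis
      using Ki i by (intro r(2)[of "fst i"]) (auto simp del: mem_ball)
  qed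
  have "(\<Sum>i\<in>p. v i - u i) = b - a"
    using additive_tagged_division_1[OF \<open>a \<le> b\<close> p, of "\<lambda>t. t"]
    by (simp add: u_def v_def case_prod_beta)
  moreover have "(\<Sum>i\<in>p - B. v i - u i) \<le> (\<Sum>i\<in>p. v i - u i)"
    using \<open>finite p\<close> uv_le by (intro sum_mono2) auto
  ultimately have "\<epsilon> * (\<Sum>i\<in>p - B. v i - u i) \<le> \<epsilon> * (b - a)"
    using \<open>\<epsilon> > 0\<close> by (intro mult_left_mono) auto
  also have "\<dots> \<le> e / 2"
    using \<open>e > 0\<close> \<open>a \<le> b\<close> by (auto simp: \<epsilon>_def divide_simps)
  finally have "- (e / 2) \<le> (\<Sum>i\<in>p - B. - \<epsilon> * (v i - u i))"
    by (simp add: sum_distrib_left sum_negf)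
  also have "\<dots> \<le> (\<Sum>i\<in>p - B. f (v i) - f (u i))"
    using good by (rule sum_mono)
  finally have "- e \<le> (\<Sum>i\<in>p - B. f (v i) - f (u i)) + (\<Sum>i\<in>B. f (v i) - f (u i))"
    using bad by simp
  also have "\<dots> = (\<Sum>i\<in>p. f (v i) - f (u i))"
    by (rule sum.subset_diff[OF \<open>B \<subseteq> p\<close> \<open>finite p\<close>, symmetric])
  also have "\<dots> = f b - f a"
    using additive_tagged_division_1[OF \<open>a \<le> b\<close> p, of f]
    by (simp add: u_def v_def case_prod_beta)
  finally show "f a \<le> f b + e" by simp
qed

section \<open>Derivatives on the unit interval\<close>

lemma D01_eqI:
  assumes "(f has_vector_derivative f') (at t within {0..1})" and "t \<in> {0..1}"
  shows "D01 f t = f'"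
  using assms vector_derivative_within_cbox[of 0 1 t f f'] by (simp add: D01_def)

lemma has_vector_derivative_D01:
  "f differentiable (at t within {0..1}) \<Longrightarrow> (f has_vector_derivative D01 f t) (at t within {0..1})"
  by (simp add: D01_def vector_derivative_works)

lemma D01_minus:
  assumes "(\<lambda>t. - f t) differentiable (at t within {0..1})" and "t \<in> {0..1}"
  shows "D01 f t = - D01 (\<lambda>t. - f t) t"
  using has_vector_derivative_minus[OF has_vector_derivative_D01[OF assms(1)]] assms(2)
  by (intro D01_eqI) auto

lemma AC2_L1_D:
  assumes "AC2_L1 f"
  shows "abs_continuous_on {0..1} f" and "abs_continuous_on {0..1} (D01 f)"
    and "t \<in> {0..1} \<Longrightarrow> f differentiable (at t within {0..1})"
    and "AE t\<in>{0..1} in lebesgue. D01 f differentiable (at t within {0..1})"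
  using assms by (auto simp: AC2_L1_def AC_L1_def)

text \<open>
  The regularity of \<open>C\<^sup>T \<lambda>\<close> and \<open>B\<^sup>T \<lambda>\<close> is given for their negatives, whereas the adjoint equation
  is stated without the sign. Since \<open>D01 f\<close> and \<open>- D01 (- f)\<close> need only agree where the derivative
  exists, the second derivative is transferred through their agreement on the whole unit interval.
\<close>

lemma D01_D01_minus:
  assumes "\<And>t. t \<in> {0..1} \<Longrightarrow> (\<lambda>t. - f t) differentiable (at t within {0..1})"
    and "D01 (\<lambda>t. - f t) differentiable (at t within {0..1})" and "t \<in> {0..1}"
  shows "D01 (D01 f) t = - D01 (D01 (\<lambda>t. - f t)) t"
proof (rule D01_eqI[OF _ \<open>t \<in> {0..1}\<close>])
  show "(D01 f has_vector_derivative - D01 (D01 (\<lambda>t. - f t)) t) (at t within {0..1})"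
    using has_vector_derivative_minus[OF has_vector_derivative_D01[OF assms(2)]]
    by (rule has_vector_derivative_transform[rotated 2])
      (use assms D01_minus in auto)
qed

section \<open>Integration by parts as an inequality\<close>

text \<open>
  The quantity assumed nonnegative is the derivative of \<open>z \<bullet> (p' + r) - z' \<bullet> p\<close>: the product rule
  produces \<open>z' \<bullet> p'\<close> twice, with opposite signs. This is integration by parts, done twice for
  \<open>p\<close> and once for \<open>r\<close>.
\<close>

lemma boundary_terms_le:
  fixes z z' p p' r :: "real \<Rightarrow> 'a::real_inner"
  assumes ac: "abs_continuous_on {0..1} z" "abs_continuous_on {0..1} z'"
      "abs_continuous_on {0..1} p" "abs_continuous_on {0..1} p'" "abs_continuous_on {0..1} r"
    and z: "\<And>t. t \<in> {0..1} \<Longrightarrow> (z has_vector_derivative z' t) (at t within {0..1})"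
    and p: "\<And>t. t \<in> {0..1} \<Longrightarrow> (p has_vector_derivative p' t) (at t within {0..1})"
    and ae: "AE t\<in>{0..1} in lebesgue.
      (z' has_vector_derivative z'' t) (at t within {0..1}) \<and>
      (p' has_vector_derivative p'' t) (at t within {0..1}) \<and>
      (r has_vector_derivative r' t) (at t within {0..1}) \<and>
      0 \<le> z t \<bullet> (p'' t + r' t) + z' t \<bullet> r t - z'' t \<bullet> p t"
  shows "z 0 \<bullet> (p' 0 + r 0) - z' 0 \<bullet> p 0 \<le> z 1 \<bullet> (p' 1 + r 1) - z' 1 \<bullet> p 1"
proof -
  obtain N where N: "N \<in> null_sets lebesgue" and
    sub: "{t \<in> space lebesgue. \<not> (t \<in> {0..1} \<longrightarrow>
      (z' has_vector_derivative z'' t) (at t within {0..1}) \<and>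
      (p' has_vector_derivative p'' t) (at t within {0..1}) \<and>
      (r has_vector_derivative r' t) (at t within {0..1}) \<and>
      0 \<le> z t \<bullet> (p'' t + r' t) + z' t \<bullet> r t - z'' t \<bullet> p t)} \<subseteq> N"
    using ae unfolding eventually_ae_filter by blast
  show ?thesis
  proof (rule abs_continuous_on_deriv_nonneg_imp_le[of 0 1 _ N])
    show "abs_continuous_on {0..1} (\<lambda>t. z t \<bullet> (p' t + r t) - z' t \<bullet> p t)"
      using ac by (intro abs_continuous_on_diff abs_continuous_on_inner abs_continuous_on_add)
    show "negligible N" using N by (simp add: negligible_iff_null_sets)
    fix t :: real assume t: "t \<in> {0..1} - N"
    have d: "(z' has_vector_derivative z'' t) (at t within {0..1})"
        "(p' has_vector_derivative p'' t) (at t within {0..1})"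
        "(r has_vector_derivative r' t) (at t within {0..1})"
      and pos: "0 \<le> z t \<bullet> (p'' t + r' t) + z' t \<bullet> r t - z'' t \<bullet> p t"
      using t sub by auto
    note inner = bounded_bilinear.has_vector_derivative[OF bounded_bilinear_inner]
    have "((\<lambda>t. z t \<bullet> (p' t + r t) - z' t \<bullet> p t) has_vector_derivative
        z t \<bullet> (p'' t + r' t) + z' t \<bullet> (p' t + r t) - (z' t \<bullet> p' t + z'' t \<bullet> p t)) (at t within {0..1})"
      using t d z[of t] p[of t]
      by (intro has_vector_derivative_diff inner has_vector_derivative_add) auto
    moreover have "z t \<bullet> (p'' t + r' t) + z' t \<bullet> (p' t + r t) - (z' t \<bullet> p' t + z'' t \<bullet> p t)
        = z t \<bullet> (p'' t + r' t) + z' t \<bullet> r t - z'' t \<bullet> p t"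
      by (simp add: inner_add_right)
    ultimately show "\<exists>f'\<ge>0. ((\<lambda>t. z t \<bullet> (p' t + r t) - z' t \<bullet> p t) has_real_derivative f')
        (at t within {0..1})"
      using pos by (metis has_real_derivative_iff_has_vector_derivative)
  qed simp
qed

section \<open>Optimality\<close>

lemma dual_cone_tangent_directions_inner_nonneg:
  assumes "w \<in> dual_cone (tangent_directions Q x)" and "y \<in> Q"
  shows "(y - x) \<bullet> w \<ge> 0"
proof -
  have "1 *\<^sub>R (y - x) \<in> tangent_directions Q x"
    using assms(2) unfolding tangent_directions_def
    by (metis (mono_tags, lifting) mem_Collect_eq zero_less_one)
  then show ?thesis using assms(1) by (auto simp: dual_cone_def)
qed

lemma inner_nonpos_nonneg_vec:
  fixes u l :: "real ^ 's"
  assumes "u \<le> 0" and "0 \<le> l"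
  shows "u \<bullet> l \<le> 0"
  using assms unfolding inner_vec_def less_eq_vec_def
  by (auto intro!: sum_nonpos mult_nonpos_nonneg)

lemma inner_transpose_mult:
  fixes M :: "real ^ 'n ^ 's"
  shows "u \<bullet> (transpose M *v v) = (M *v u) \<bullet> v"
  by (simp add: dot_lmul_matrix inner_commute[of u] inner_commute[of v])

theorem theorem5p1:
  fixes A B C :: "real ^ 'n ^ 's"
    and d :: "real ^ 's"
    and \<phi> :: "(real ^ 'n) \<times> (real ^ 'n) \<Rightarrow> real"
    and Q0 Q1 :: "(real ^ 'n) set"
    and x :: "real \<Rightarrow> real ^ 'n"
  assumes "continuous_on UNIV \<phi>" and "convex_on UNIV \<phi>"
    and "convex Q0" and "Q0 \<noteq> {}" and "convex Q1" and "Q1 \<noteq> {}"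
    and "feasible_trajectory (polyhedral_map A B C d) Q0 Q1 x"
    and "\<exists>l :: real \<Rightarrow> real ^ 's.
      (\<forall>t\<in>{0..1}. 0 \<le> l t) \<and>
      AC2_L1 (\<lambda>t. - (transpose C *v l t)) \<and>
      AC_L1 (\<lambda>t. - (transpose B *v l t)) \<and>
      (let Cl = (\<lambda>t. transpose C *v l t); Bl = (\<lambda>t. transpose B *v l t) in
        (AE t\<in>{0..1} in lebesgue.
           D01 (D01 Cl) t + D01 Bl t - transpose A *v l t = 0 \<and>
           (A *v x t + B *v D01 x t - C *v D01 (D01 x) t - d) \<bullet> l t = 0) \<and>
        - D01 Cl 0 - Bl 0 \<in> dual_cone (tangent_directions Q0 (x 0)) \<and>
        Cl 0 \<in> dual_cone (tangent_directions Q1 (D01 x 0)) \<and>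
        (- D01 Cl 1 - Bl 1, Cl 1) \<in> subdifferential \<phi> (x 1, D01 x 1))"
  shows "optimal_trajectory \<phi> (polyhedral_map A B C d) Q0 Q1 x"
proof -
  obtain l :: "real \<Rightarrow> real ^ 's" where l: "\<And>t. t \<in> {0..1} \<Longrightarrow> 0 \<le> l t"
    and pAC: "AC2_L1 (\<lambda>t. - (transpose C *v l t))"
    and rAC: "AC_L1 (\<lambda>t. - (transpose B *v l t))"
    and adj: "AE t\<in>{0..1} in lebesgue.
      D01 (D01 (\<lambda>t. transpose C *v l t)) t + D01 (\<lambda>t. transpose B *v l t) t
        - transpose A *v l t = 0 \<and>
      (A *v x t + B *v D01 x t - C *v D01 (D01 x) t - d) \<bullet> l t = 0"
    and tr0: "- D01 (\<lambda>t. transpose C *v l t) 0 - transpose B *v l 0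
      \<in> dual_cone (tangent_directions Q0 (x 0))"
    and tr1: "transpose C *v l 0 \<in> dual_cone (tangent_directions Q1 (D01 x 0))"
    and sub: "(- D01 (\<lambda>t. transpose C *v l t) 1 - transpose B *v l 1, transpose C *v l 1)
      \<in> subdifferential \<phi> (x 1, D01 x 1)"
    using assms(8) unfolding Let_def by blast
  define p where "p t = - (transpose C *v l t)" for t
  define r where "r t = - (transpose B *v l t)" for t
  note pD = AC2_L1_D[OF pAC, folded p_def]
  have rD: "abs_continuous_on {0..1} r"
    "AE t\<in>{0..1} in lebesgue. r differentiable (at t within {0..1})"
    using rAC by (simp_all add: AC_L1_def r_def[abs_def])
  have D_Cl: "D01 (\<lambda>t. transpose C *v l t) t = - D01 p t" if "t \<in> {0..1}" for t
    using D01_minus[of "\<lambda>t. transpose C *v l t" t] pD(3)[OF that] that by (simp add: p_def[abs_def])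
  have xD: "AC2_L1 x"
    and x_ae: "AE t\<in>{0..1} in lebesgue. D01 (D01 x) t \<in> polyhedral_map A B C d (x t, D01 x t)"
    using assms(7) by (auto simp: feasible_trajectory_def)
  have "\<phi> (x 1, D01 x 1) \<le> \<phi> (y 1, D01 y 1)"
    if y: "feasible_trajectory (polyhedral_map A B C d) Q0 Q1 y" for y
  proof -
    have yD: "AC2_L1 y" "y 0 \<in> Q0" "D01 y 0 \<in> Q1"
      and y_ae: "AE t\<in>{0..1} in lebesgue. D01 (D01 y) t \<in> polyhedral_map A B C d (y t, D01 y t)"
      using y by (auto simp: feasible_trajectory_def)
    define z z' z'' where "z t = y t - x t" and "z' t = D01 y t - D01 x t"
      and "z'' t = D01 (D01 y) t - D01 (D01 x) t" for t
    have "AE t\<in>{0..1} in lebesgue.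
      (z' has_vector_derivative z'' t) (at t within {0..1}) \<and>
      (D01 p has_vector_derivative D01 (D01 p) t) (at t within {0..1}) \<and>
      (r has_vector_derivative D01 r t) (at t within {0..1}) \<and>
      0 \<le> z t \<bullet> (D01 (D01 p) t + D01 r t) + z' t \<bullet> r t - z'' t \<bullet> p t"
      using AC2_L1_D(4)[OF xD] AC2_L1_D(4)[OF yD(1)] pD(4) rD(2) adj y_ae
    proof eventually_elim
      case (elim t)
      show ?case
      proof
        assume t: "t \<in> {0..1}"
        have "D01 (D01 (\<lambda>t. transpose C *v l t)) t = - D01 (D01 p) t"
          using D01_D01_minus[of "\<lambda>t. transpose C *v l t" t] pD(3) elim(3) t
          by (simp add: p_def[abs_def])
        moreover have "D01 (\<lambda>t. transpose B *v l t) t = - D01 r t"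
          using D01_minus[of "\<lambda>t. transpose B *v l t" t] elim(4) t by (simp add: r_def[abs_def])
        ultimately have "- D01 (D01 p) t - D01 r t = transpose A *v l t"
          using elim(5) t by (auto simp del: transpose_matrix_vector)
        from this[symmetric] have eq: "D01 (D01 p) t + D01 r t = - (transpose A *v l t)"
          by (simp del: transpose_matrix_vector)
        have "A *v y t + B *v D01 y t - C *v D01 (D01 y) t \<le> d"
          using elim(6) t by (simp add: polyhedral_map_def)
        then have "(A *v y t + B *v D01 y t - C *v D01 (D01 y) t - d) \<bullet> l t \<le> 0"
          using l[OF t] by (intro inner_nonpos_nonneg_vec) auto
        moreover have "(A *v x t + B *v D01 x t - C *v D01 (D01 x) t - d) \<bullet> l t = 0"
          using elim(5) t by simp
        \<comment> \<open>The vector \<open>d\<close> cancels between the two residuals.\<close>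
        ultimately have "(A *v z t + B *v z' t - C *v z'' t) \<bullet> l t \<le> 0"
          by (simp add: z_def z'_def z''_def matrix_vector_mult_diff_distrib inner_diff_left
              inner_add_left)
        then have "0 \<le> z t \<bullet> (D01 (D01 p) t + D01 r t) + z' t \<bullet> r t - z'' t \<bullet> p t"
          unfolding eq r_def p_def
          by (simp add: inner_diff_left inner_add_left inner_transpose_mult
              del: transpose_matrix_vector)
        then show "(z' has_vector_derivative z'' t) (at t within {0..1}) \<and>
          (D01 p has_vector_derivative D01 (D01 p) t) (at t within {0..1}) \<and>
          (r has_vector_derivative D01 r t) (at t within {0..1}) \<and>
          0 \<le> z t \<bullet> (D01 (D01 p) t + D01 r t) + z' t \<bullet> r t - z'' t \<bullet> p t"
          using elim(1-4) t unfolding z'_def z''_def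
          by (auto intro!: has_vector_derivative_diff has_vector_derivative_D01)
      qed
    qed
    then have "z 0 \<bullet> (D01 p 0 + r 0) - z' 0 \<bullet> p 0 \<le> z 1 \<bullet> (D01 p 1 + r 1) - z' 1 \<bullet> p 1"
      using pD rD(1) AC2_L1_D[OF xD] AC2_L1_D[OF yD(1)]
      by (intro boundary_terms_le[where z'' = z'' and p'' = "D01 (D01 p)" and r' = "D01 r"])
        (auto simp: z_def[abs_def] z'_def[abs_def]
          intro!: abs_continuous_on_diff has_vector_derivative_diff has_vector_derivative_D01)
    moreover have "z 0 \<bullet> (D01 p 0 + r 0) \<ge> 0"
      using dual_cone_tangent_directions_inner_nonneg[OF tr0 yD(2)] D_Cl[of 0]
      by (simp add: z_def r_def)
    moreover have "z' 0 \<bullet> p 0 \<le> 0"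
      using dual_cone_tangent_directions_inner_nonneg[OF tr1 yD(3)] by (simp add: z'_def p_def)
    moreover have "z 1 \<bullet> (D01 p 1 + r 1) - z' 1 \<bullet> p 1 \<le> \<phi> (y 1, D01 y 1) - \<phi> (x 1, D01 x 1)"
    proof -
      have "(D01 p 1 + r 1, - p 1) \<in> subdifferential \<phi> (x 1, D01 x 1)"
        using sub D_Cl[of 1] by (simp add: r_def p_def)
      then have "(D01 p 1 + r 1, - p 1) \<bullet> ((y 1, D01 y 1) - (x 1, D01 x 1))
          \<le> \<phi> (y 1, D01 y 1) - \<phi> (x 1, D01 x 1)"
        unfolding subdifferential_def by blast
      then show ?thesis by (simp add: z_def z'_def inner_commute)
    qed
    ultimately show ?thesis by linarith
  qed
  then show ?thesis using assms(7) by (simp add: optimal_trajectory_def)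
qed

end
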